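(* Let $Z$ be a Banach space over $\mathbb{K}$, let $u\in S_Z$, and let $\Lambda\subset B_{Z^*}$ be one-norming for $Z$. Then, for $z\in Z$, the following are equivalent: (i) $u\perp_B z$; (ii) $0\in\operatorname{conv}\bigl(\{\theta_0\lim\psi_n(z)\colon \psi_n\in\Lambda\ \forall n\in\mathbb{N},\ \theta_0\in\mathbb{T},\ \lim\psi_n(u)=\overline{\theta_0}\}\bigr)$; (iii) $0\in\operatorname{conv}\bigl(\{\lim\psi_n(z)\overline{\psi_n(u)}\colon \psi_n\in\Lambda\ \forall n\in\mathbb{N},\ \lim|\psi_n(u)|=1\}\bigr)$; (iv) $0\in\operatorname{conv}\Bigl(\bigcap_{\delta>0}\overline{\{\psi(z)\overline{\psi(u)}\colon \psi\in\Lambda,\ |\psi(u)|>1-\delta\}}\Bigr)$; (v) $0\in\bigcap_{\delta>0}\operatorname{conv}\Bigl(\overline{\{\psi(z)\overline{\psi(u)}\colon \psi\in\Lambda,\ |\psi(u)|>1-\delta\}}\Bigr)$.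
   Context: $\mathbb{K}$ is $\mathbb{R}$ or $\mathbb{C}$, $\mathbb{T}$ is the set of modulus-one scalars of $\mathbb{K}$. $B_Z$ and $S_Z$ are the closed unit ball and unit sphere of $Z$, $Z^*$ is the topological dual. $x\perp_B y$ (Birkhoff-James orthogonality) means $\|x+\lambda y\|\geq\|x\|$ for all $\lambda\in\mathbb{K}$. A subset $\Lambda\subset B_{Z^*}$ is one-norming for $Z$ if $\|z\|=\sup\{|\phi(z)|\colon \phi\in\Lambda\}$ for all $z\in Z$. $\operatorname{conv}$ is the convex hull; a bar over a set of scalars is its closure, and a bar over a scalar is complex conjugation. Writing $\lim a_n$ for a bounded scalar sequence means that the sequence is required to be convergent. *)

theory Defs
  imports "HOL-Analysis.Analysis"
begin

text \<open>
  The scalar field is either the field of real or the field of complex numbers, seen through an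
  isometric field embedding into \<^typ>\<open>complex\<close> whose range is the reals or everything. The
  superclass \<^class>\<open>euclidean_space\<close> only records the (norm-induced) finite-dimensional real
  inner product structure of the scalars. Both \<^typ>\<open>real\<close> and \<^typ>\<open>complex\<close> are instances, so a
  theorem over this class covers both cases.
\<close>

class real_or_complex = real_normed_field + euclidean_space +
  fixes to_complex :: "'a \<Rightarrow> complex"
    and scalar_cnj :: "'a \<Rightarrow> 'a"
  assumes to_complex_add: "to_complex (a + b) = to_complex a + to_complex b"
    and to_complex_mult: "to_complex (a * b) = to_complex a * to_complex b"
    and to_complex_scaleR: "to_complex (scaleR r a) = scaleR r (to_complex a)"
    and norm_to_complex: "norm (to_complex a) = norm a"
    and range_to_complex: "range to_complex = \<real> \<or> range to_complex = UNIV"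
    and to_complex_scalar_cnj: "to_complex (scalar_cnj a) = cnj (to_complex a)"

instantiation real :: real_or_complex
begin

definition to_complex_real :: "real \<Rightarrow> complex"
  where "to_complex_real = complex_of_real"

definition scalar_cnj_real :: "real \<Rightarrow> real"
  where "scalar_cnj_real a = a"

instance
  by standard (simp_all add: to_complex_real_def scalar_cnj_real_def Reals_def scaleR_conv_of_real)

end

instantiation complex :: real_or_complex
begin

definition to_complex_complex :: "complex \<Rightarrow> complex"
  where "to_complex_complex a = a"

definition scalar_cnj_complex :: "complex \<Rightarrow> complex"
  where "scalar_cnj_complex = cnj"

instance
  by standard (simp_all add: to_complex_complex_def scalar_cnj_complex_def)

end

text \<open>
  A normed space over the scalar field: the type class supplies the norm and the underlying real
  structure, which the scalar multiplication \<open>smul\<close> has to extend. For real scalars this forces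
  \<open>smul\<close> to be \<^const>\<open>scaleR\<close>.
\<close>

locale normed_space_over = vector_space smul
  for smul :: "'k::real_or_complex \<Rightarrow> 'z::real_normed_vector \<Rightarrow> 'z" +
  assumes norm_smul: "norm (smul a x) = norm a * norm x"
    and smul_of_real: "smul (of_real r) x = r *\<^sub>R x"

definition topological_dual ::
    "('k::real_or_complex \<Rightarrow> 'z::real_normed_vector \<Rightarrow> 'z) \<Rightarrow> ('z \<Rightarrow> 'k) set"
  where "topological_dual smul =
    {\<phi>. Vector_Spaces.linear smul (*) \<phi> \<and> continuous_on UNIV \<phi>}"

definition dual_unit_ball ::
    "('k::real_or_complex \<Rightarrow> 'z::real_normed_vector \<Rightarrow> 'z) \<Rightarrow> ('z \<Rightarrow> 'k) set"
  where "dual_unit_ball smul = {\<phi> \<in> topological_dual smul. onorm \<phi> \<le> 1}"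

text \<open>
  For \<open>\<Lambda>\<close> contained in the dual unit ball the supremum below is over a bounded set; as \<open>norm 0 = 0\<close>,
  the empty set can only be one-norming for the zero space, whatever the value of \<open>Sup {}\<close>.
\<close>

definition one_norming :: "('z::real_normed_vector \<Rightarrow> 'k::real_or_complex) set \<Rightarrow> bool"
  where "one_norming \<Lambda> \<longleftrightarrow> (\<forall>z. norm z = (SUP \<phi>\<in>\<Lambda>. norm (\<phi> z)))"

definition birkhoff_james_orthogonal ::
    "('k::real_or_complex \<Rightarrow> 'z::real_normed_vector \<Rightarrow> 'z) \<Rightarrow> 'z \<Rightarrow> 'z \<Rightarrow> bool"
  where "birkhoff_james_orthogonal smul x y \<longleftrightarrow> (\<forall>c. norm (x + smul c y) \<ge> norm x)"

end

theory Submission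
  imports Defs
begin

text \<open>
  For a functional \<open>\<psi>\<close> put \<open>w \<psi> = \<psi> z * cnj (\<psi> u)\<close>. Then
  \<open>|\<psi> (u + c z)|\<^sup>2 = |\<psi> u|\<^sup>2 + 2 \<langle>w \<psi>, cnj c\<rangle> + |c \<psi> z|\<^sup>2\<close>. If the compact convex hull of the limits of
  \<open>w \<psi>\<^sub>n\<close> along \<open>|\<psi>\<^sub>n u| \<longrightarrow> 1\<close> misses the origin, separate it by a functional \<open>\<langle>a, _\<rangle>\<close> and choose
  \<open>\<psi>\<^sub>n\<close> that almost norm \<open>u - t\<^sub>n cnj a z\<close> with \<open>t\<^sub>n \<longrightarrow> 0\<close>: orthogonality forces
  \<open>\<langle>a, w \<psi>\<^sub>n\<rangle> \<le> O(t\<^sub>n)\<close>, and a limit point of \<open>w \<psi>\<^sub>n\<close> contradicts the separation. The limit sets in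
  (ii), (iii) and (iv) coincide because the scalar field is locally compact.
\<close>

section \<open>Conjugation and inner product of the scalar field\<close>

lemma to_complex_eq_iff: "to_complex a = to_complex b \<longleftrightarrow> a = b"
proof
  assume eq: "to_complex a = to_complex b"
  have "to_complex (a + (-1) *\<^sub>R b) = 0"
    unfolding to_complex_add to_complex_scaleR eq by simp
  then have "norm (a + (-1) *\<^sub>R b) = 0"
    using norm_to_complex[of "a + (-1) *\<^sub>R b"] by simp
  then show "a = b" by simp
qed simp

text \<open>By polarization the inner product is determined by the norm, which
  \<open>to_complex\<close> preserves. Inner product identities can therefore be checked in the
  complex plane.\<close>

lemma inner_conv_to_complex: "a \<bullet> b = to_complex a \<bullet> to_complex b"
  using dot_norm[of a b] dot_norm[of "to_complex a" "to_complex b"]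
  by (metis norm_to_complex to_complex_add)

lemma norm_scalar_cnj [simp]: "norm (scalar_cnj a) = norm a"
  using norm_to_complex[of "scalar_cnj a"] norm_to_complex[of a]
  by (simp add: to_complex_scalar_cnj)

lemma scalar_cnj_scalar_cnj [simp]: "scalar_cnj (scalar_cnj a) = a"
  by (simp flip: to_complex_eq_iff add: to_complex_scalar_cnj)

lemma linear_scalar_cnj: "linear (scalar_cnj :: 'k \<Rightarrow> 'k::real_or_complex)"
  by (rule linearI)
    (simp_all flip: to_complex_eq_iff
      add: to_complex_scalar_cnj to_complex_add to_complex_scaleR)

lemmas tendsto_scalar_cnj =
  bounded_linear.tendsto[OF linear_scalar_cnj[unfolded linear_conv_bounded_linear]]

text \<open>Both sides are the real part of \<open>c * y * cnj x\<close>. With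
  \<open>y = \<psi> z\<close> and \<open>x = \<psi> u\<close> this makes the cross term between
  \<open>c * \<psi> z\<close> and \<open>\<psi> u\<close> a real linear function of
  \<open>\<psi> z * scalar_cnj (\<psi> u)\<close>, so that half-spaces of products can be
  used.\<close>

lemma inner_mult_left_scalar_cnj:
  "(c * y) \<bullet> x = (y * scalar_cnj x) \<bullet> scalar_cnj (c::'k::real_or_complex)"
  by (simp add: inner_conv_to_complex[where ?'a = 'k] to_complex_mult to_complex_scalar_cnj
      inner_complex_def algebra_simps)

section \<open>Functionals in the dual ball and one-norming sets\<close>

lemma bounded_linear_topological_dual:
  assumes "normed_space_over smul" "\<phi> \<in> topological_dual smul"
  shows "bounded_linear \<phi>"
proof -
  interpret normed_space_over smul by fact
  have lin: "Vector_Spaces.linear smul (*) \<phi>" and cont: "continuous_on UNIV \<phi>"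
    using assms(2) by (auto simp: topological_dual_def)
  interpret \<phi>: Vector_Spaces.linear smul "(*)" \<phi> by fact
  \<comment> \<open>\<open>bounded_linear\<close> and \<open>onorm\<close> refer to the real
    structure, so homogeneity is restricted to real scalars.\<close>
  have scale: "\<phi> (r *\<^sub>R x) = r *\<^sub>R \<phi> x" for r x
    using \<phi>.scale[of "of_real r" x] by (simp add: smul_of_real scaleR_conv_of_real)
  have "isCont \<phi> 0"
    using cont by (simp add: continuous_on_eq_continuous_at)
  then obtain d where d: "d > 0" "\<And>x. dist x 0 < d \<Longrightarrow> dist (\<phi> x) (\<phi> 0) < 1"
    unfolding continuous_at_eps_delta by (metis zero_less_one)
  have "norm (\<phi> x) \<le> norm x * (2 / d)" for x
  proof (cases "x = 0")
    case False
    \<comment> \<open>Rescaling to norm \<open>d / 2\<close> lands strictly inside the ball on which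
      \<open>\<phi>\<close> is bounded by 1.\<close>
    define r where "r = d / (2 * norm x)"
    have r: "r > 0" using False d by (simp add: r_def)
    have "norm (r *\<^sub>R x) < d" using False d by (simp add: r_def)
    then have "norm (\<phi> (r *\<^sub>R x)) < 1" using d(2)[of "r *\<^sub>R x"] by simp
    then have "r * norm (\<phi> x) \<le> 1" using r by (simp add: scale)
    then show ?thesis using False d by (simp add: r_def field_simps)
  qed simp
  then show ?thesis
    by (intro bounded_linear_intro[of \<phi> "2 / d"] \<phi>.add scale)
qed

lemma dual_unit_ball_norm_le:
  assumes "normed_space_over smul" "\<phi> \<in> dual_unit_ball smul"
  shows "norm (\<phi> x) \<le> norm x"
proof -
  have bl: "bounded_linear \<phi>" and on: "onorm \<phi> \<le> 1"
    using assms bounded_linear_topological_dual by (auto simp: dual_unit_ball_def)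
  have "norm (\<phi> x) \<le> onorm \<phi> * norm x" by (rule onorm[OF bl])
  also have "\<dots> \<le> 1 * norm x" using on by (intro mult_right_mono) auto
  finally show ?thesis by simp
qed

lemma dual_unit_ball_add_smul:
  assumes "\<phi> \<in> dual_unit_ball smul"
  shows "\<phi> (x + smul c y) = \<phi> x + c * \<phi> y"
proof -
  interpret \<phi>: Vector_Spaces.linear smul "(*)" \<phi>
    using assms by (auto simp: dual_unit_ball_def topological_dual_def)
  show ?thesis by (simp add: \<phi>.add \<phi>.scale)
qed

lemma one_norming_approx:
  fixes \<Lambda> :: "('z::real_normed_vector \<Rightarrow> 'k::real_or_complex) set"
  assumes "normed_space_over smul" "\<Lambda> \<subseteq> dual_unit_ball smul" "one_norming \<Lambda>"
    and "x \<noteq> 0" "r < norm x"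
  obtains \<phi> where "\<phi> \<in> \<Lambda>" "r < norm (\<phi> x)"
proof -
  have sup: "norm y = (SUP \<phi>\<in>\<Lambda>. norm (\<phi> y))" for y
    using assms(3) by (auto simp: one_norming_def)
  \<comment> \<open>For empty \<open>\<Lambda>\<close> the norms of \<open>0\<close> and
    \<open>x\<close> would both equal the same value \<open>Sup {}\<close>, although
    \<open>x \<noteq> 0\<close>.\<close>
  have "\<Lambda> \<noteq> {}"
    using sup[of 0] sup[of x] \<open>x \<noteq> 0\<close> by auto
  moreover have "bdd_above ((\<lambda>\<phi>. norm (\<phi> x)) ` \<Lambda>)"
    using dual_unit_ball_norm_le[OF assms(1)] assms(2) by (intro bdd_aboveI2) blast
  ultimately show ?thesis
    using that less_cSUP_iff[of \<Lambda> "\<lambda>\<phi>. norm (\<phi> x)" r] sup[of x] assms(5) by auto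
qed

section \<open>Three descriptions of one limit set\<close>

context
  fixes \<Lambda> :: "('z \<Rightarrow> 'k::real_or_complex) set" and u z :: 'z
begin

text \<open>The sets whose closures occur in (iv) and (v); the next two definitions are the sets of
  (iii) and (ii). Each is written as in the theorem, so that unfolding recovers its
  conditions.\<close>

definition near_norming_values :: "real \<Rightarrow> 'k set" where
  "near_norming_values \<delta> = {\<psi> z * scalar_cnj (\<psi> u) | \<psi>. \<psi> \<in> \<Lambda> \<and> norm (\<psi> u) > 1 - \<delta>}"

definition limit_values :: "'k set" where
  "limit_values = {l | l \<psi>. (\<forall>n::nat. \<psi> n \<in> \<Lambda>) \<and>
     (\<lambda>n. norm (\<psi> n u)) \<longlonglongrightarrow> 1 \<and> (\<lambda>n. \<psi> n z * scalar_cnj (\<psi> n u)) \<longlonglongrightarrow> l}"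

definition rotated_limit_values :: "'k set" where
  "rotated_limit_values = {\<theta>\<^sub>0 * l | \<theta>\<^sub>0 l \<psi>. (\<forall>n::nat. \<psi> n \<in> \<Lambda>) \<and> \<theta>\<^sub>0 \<in> sphere 0 1 \<and>
     (\<lambda>n. \<psi> n u) \<longlonglongrightarrow> scalar_cnj \<theta>\<^sub>0 \<and> (\<lambda>n. \<psi> n z) \<longlonglongrightarrow> l}"

text \<open>Conjugating the limit of \<open>\<psi> n u\<close> gives \<open>\<theta>\<close>, so the
  products converge to \<open>\<theta> * l\<close>. This is the first of three inclusions forming a
  cycle.\<close>

lemma rotated_limit_values_subset: "rotated_limit_values \<subseteq> limit_values"
proof
  fix w assume "w \<in> rotated_limit_values"
  then obtain \<theta> l \<psi> where w: "w = \<theta> * l" and \<psi>: "\<forall>n::nat. \<psi> n \<in> \<Lambda>" and \<theta>: "norm \<theta> = 1"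
    and lu: "(\<lambda>n. \<psi> n u) \<longlonglongrightarrow> scalar_cnj \<theta>" and lz: "(\<lambda>n. \<psi> n z) \<longlonglongrightarrow> l"
    by (auto simp: rotated_limit_values_def)
  have "(\<lambda>n. norm (\<psi> n u)) \<longlonglongrightarrow> 1"
    using tendsto_norm[OF lu] \<theta> by simp
  moreover have "(\<lambda>n. \<psi> n z * scalar_cnj (\<psi> n u)) \<longlonglongrightarrow> w"
    using tendsto_mult[OF lz tendsto_scalar_cnj[OF lu]] by (simp add: w mult.commute)
  ultimately show "w \<in> limit_values"
    using \<psi> by (auto simp: limit_values_def)
qed

text \<open>For each \<open>\<delta>\<close> a tail of the sequence of products lies in the
  corresponding set.\<close>

lemma limit_values_subset: "limit_values \<subseteq> (\<Inter>\<delta>\<in>{0<..}. closure (near_norming_values \<delta>))"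
proof
  fix l assume "l \<in> limit_values"
  then obtain \<psi> where \<psi>: "\<forall>n::nat. \<psi> n \<in> \<Lambda>" and lu: "(\<lambda>n. norm (\<psi> n u)) \<longlonglongrightarrow> 1"
    and l: "(\<lambda>n. \<psi> n z * scalar_cnj (\<psi> n u)) \<longlonglongrightarrow> l"
    by (auto simp: limit_values_def)
  have "l \<in> closure (near_norming_values \<delta>)" if "\<delta> > 0" for \<delta>
  proof -
    have "\<forall>\<^sub>F n in sequentially. norm (\<psi> n u) > 1 - \<delta>"
      using order_tendstoD(1)[OF lu] that by simp
    then have "\<forall>\<^sub>F n in sequentially. \<psi> n z * scalar_cnj (\<psi> n u) \<in> closure (near_norming_values \<delta>)"
      by eventually_elim
        (rule subsetD[OF closure_subset], use \<psi> in \<open>auto simp: near_norming_values_def\<close>)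
    then show ?thesis
      by (rule Lim_in_closed_set[OF closed_closure _ sequentially_bot l])
  qed
  then show "l \<in> (\<Inter>\<delta>\<in>{0<..}. closure (near_norming_values \<delta>))" by auto
qed

text \<open>Choosing \<open>\<psi> n\<close> for \<open>\<delta> = 1 / (n + 1)\<close> makes the
  products converge to \<open>l\<close>. The two factors need not converge separately; the uniform
  bounds supply a subsequence along which they do.\<close>

lemma Inter_closure_near_norming_values_subset:
  assumes leu: "\<And>\<psi>. \<psi> \<in> \<Lambda> \<Longrightarrow> norm (\<psi> u) \<le> 1" and lez: "\<And>\<psi>. \<psi> \<in> \<Lambda> \<Longrightarrow> norm (\<psi> z) \<le> M"
  shows "(\<Inter>\<delta>\<in>{0<..}. closure (near_norming_values \<delta>)) \<subseteq> rotated_limit_values"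
proof
  fix l assume l: "l \<in> (\<Inter>\<delta>\<in>{0<..}. closure (near_norming_values \<delta>))"
  have "\<exists>\<psi>. \<psi> \<in> \<Lambda> \<and> norm (\<psi> u) > 1 - inverse (real (Suc n)) \<and>
      dist (\<psi> z * scalar_cnj (\<psi> u)) l < inverse (real (Suc n))" for n
  proof -
    have "l \<in> closure (near_norming_values (inverse (real (Suc n))))"
      using l by auto
    then obtain w where "w \<in> near_norming_values (inverse (real (Suc n)))"
      "dist w l < inverse (real (Suc n))"
      by (meson closure_approachable inverse_positive_iff_positive of_nat_0_less_iff zero_less_Suc)
    then show ?thesis by (auto simp: near_norming_values_def)
  qed
  then obtain \<psi> where \<psi>: "\<And>n. \<psi> n \<in> \<Lambda>" and gt: "\<And>n. norm (\<psi> n u) > 1 - inverse (real (Suc n))"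
    and near: "\<And>n. dist (\<psi> n z * scalar_cnj (\<psi> n u)) l < inverse (real (Suc n))"
    by metis
  have "(\<lambda>n. norm (\<psi> n u)) \<longlonglongrightarrow> 1"
  proof (rule tendsto_sandwich[of "\<lambda>n. 1 - inverse (real (Suc n))" _ _ "\<lambda>_. 1"])
    show "(\<lambda>n. 1 - inverse (real (Suc n))) \<longlonglongrightarrow> 1"
      using tendsto_diff[OF tendsto_const LIMSEQ_inverse_real_of_nat, of 1] by simp
  qed (use gt leu \<psi> in \<open>auto intro!: always_eventually less_imp_le\<close>)
  moreover have w: "(\<lambda>n. \<psi> n z * scalar_cnj (\<psi> n u)) \<longlonglongrightarrow> l"
  proof (rule metric_tendsto_imp_tendsto[OF LIMSEQ_inverse_real_of_nat])
    show "\<forall>\<^sub>F n in sequentially. dist (\<psi> n z * scalar_cnj (\<psi> n u)) l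
        \<le> dist (inverse (real (Suc n))) 0"
      using near by (intro always_eventually allI) (auto intro: less_imp_le)
  qed
  \<comment> \<open>Working with pairs yields a single subsequence along which both factors
    converge.\<close>
  moreover have "bounded (range (\<lambda>n. (\<psi> n u, \<psi> n z)))"
  proof -
    have "range (\<lambda>n. (\<psi> n u, \<psi> n z)) \<subseteq> cball 0 1 \<times> cball 0 M"
      using leu lez \<psi> by auto
    then show ?thesis by (rule bounded_subset[rotated]) (intro bounded_Times bounded_cball)
  qed
  then obtain p r where r: "strict_mono (r :: nat \<Rightarrow> nat)"
    and p: "((\<lambda>n. (\<psi> n u, \<psi> n z)) \<circ> r) \<longlonglongrightarrow> p"
    using bounded_imp_convergent_subsequence by blast
  have pu: "(\<lambda>n. \<psi> (r n) u) \<longlonglongrightarrow> fst p" and pz: "(\<lambda>n. \<psi> (r n) z) \<longlonglongrightarrow> snd p"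
    using tendsto_fst[OF p] tendsto_snd[OF p] by (simp_all add: o_def)
  ultimately have "norm (fst p) = 1"
    using LIMSEQ_unique[OF tendsto_norm[OF pu] LIMSEQ_subseq_LIMSEQ[OF _ r, unfolded o_def]] by simp
  moreover have "l = scalar_cnj (fst p) * snd p"
    using LIMSEQ_unique[OF LIMSEQ_subseq_LIMSEQ[OF w r, unfolded o_def]
        tendsto_mult[OF pz tendsto_scalar_cnj[OF pu]]]
    by (simp add: mult.commute)
  \<comment> \<open>The rotation is the conjugate of the limit of \<open>\<psi> (r n) u\<close>;
    conjugating it again gives back that limit.\<close>
  ultimately have "l = scalar_cnj (fst p) * snd p \<and> (\<forall>n. \<psi> (r n) \<in> \<Lambda>) \<and>
      scalar_cnj (fst p) \<in> sphere 0 1 \<and> (\<lambda>n. \<psi> (r n) u) \<longlonglongrightarrow> scalar_cnj (scalar_cnj (fst p)) \<and>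
      (\<lambda>n. \<psi> (r n) z) \<longlonglongrightarrow> snd p"
    using \<psi> pu pz by auto
  then show "l \<in> rotated_limit_values"
    unfolding rotated_limit_values_def mem_Collect_eq
    by - (rule exI[of _ "scalar_cnj (fst p)"], rule exI[of _ "snd p"],
        rule exI[of _ "\<lambda>n. \<psi> (r n)"])
qed

end

section \<open>Orthogonality and convex hulls\<close>

context
  fixes smul :: "'k::real_or_complex \<Rightarrow> 'z::real_normed_vector \<Rightarrow> 'z"
    and \<Lambda> :: "('z \<Rightarrow> 'k) set" and u z :: 'z
  assumes space: "normed_space_over smul" and norm_u: "norm u = 1"
    and ball: "\<Lambda> \<subseteq> dual_unit_ball smul"
begin

lemma norm_value_le: "\<psi> \<in> \<Lambda> \<Longrightarrow> norm (\<psi> x) \<le> norm x"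
  using dual_unit_ball_norm_le[OF space] ball by blast

lemma value_add_smul: "\<psi> \<in> \<Lambda> \<Longrightarrow> \<psi> (x + smul c y) = \<psi> x + c * \<psi> y"
  using dual_unit_ball_add_smul ball by blast

lemma norm_value_product_le:
  assumes "\<psi> \<in> \<Lambda>"
  shows "norm (\<psi> z * scalar_cnj (\<psi> u)) \<le> norm z"
  using mult_mono[OF norm_value_le[OF assms, of z] norm_value_le[OF assms, of u]]
  by (simp add: norm_mult norm_u)

text \<open>Pairing \<open>\<psi> (u + smul c z)\<close> with \<open>\<psi> u\<close> and applying
  Cauchy-Schwarz puts all near-norming products into a closed half-space \<open>H\<close>. It then
  contains the convex hull of their closure, and \<open>0 \<in> H\<close> is the bound
  \<open>(1 - \<delta>)\<^sup>2 \<le> norm (u + smul c z)\<close>.\<close>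

lemma birkhoff_james_orthogonal_if_hull:
  assumes "\<And>\<delta>. \<delta> > 0 \<Longrightarrow> 0 \<in> convex hull (closure (near_norming_values \<Lambda> u z \<delta>))"
  shows "birkhoff_james_orthogonal smul u z"
proof -
  have "1 \<le> norm (u + smul c z)" for c
  proof (rule field_le_epsilon)
    fix e :: real assume "e > 0"
    \<comment> \<open>The bound by 1 keeps \<open>1 - \<delta>\<close> nonnegative, as squaring
      requires; the bound by \<open>e / 2\<close> makes the loss \<open>2 * \<delta>\<close> at most
      \<open>e\<close>.\<close>
    define \<delta> where "\<delta> = min 1 (e / 2)"
    have \<delta>: "0 < \<delta>" "\<delta> \<le> 1" "2 * \<delta> \<le> e" using \<open>e > 0\<close> by (auto simp: \<delta>_def)
    define H where "H = {w. scalar_cnj c \<bullet> w \<le> norm (u + smul c z) - (1 - \<delta>)\<^sup>2}"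
    have "near_norming_values \<Lambda> u z \<delta> \<subseteq> H"
    proof
      fix w assume "w \<in> near_norming_values \<Lambda> u z \<delta>"
      then obtain \<psi> where w: "w = \<psi> z * scalar_cnj (\<psi> u)" and \<psi>: "\<psi> \<in> \<Lambda>"
        and gt: "norm (\<psi> u) > 1 - \<delta>"
        by (auto simp: near_norming_values_def)
      have "(1 - \<delta>)\<^sup>2 + scalar_cnj c \<bullet> w \<le> (norm (\<psi> u))\<^sup>2 + scalar_cnj c \<bullet> w"
        using gt \<delta> by (intro add_right_mono power_mono) auto
      also have "\<dots> = \<psi> (u + smul c z) \<bullet> \<psi> u"
        using inner_mult_left_scalar_cnj[of c "\<psi> z" "\<psi> u"]
        by (simp add: value_add_smul[OF \<psi>] inner_add_left w inner_commute[of "scalar_cnj c"]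
            power2_norm_eq_inner)
      also have "\<dots> \<le> norm (\<psi> (u + smul c z)) * norm (\<psi> u)"
        by (rule norm_cauchy_schwarz)
      also have "\<dots> \<le> norm (u + smul c z) * 1"
        using norm_value_le[OF \<psi>, of u] norm_value_le[OF \<psi>, of "u + smul c z"] norm_u
        by (intro mult_mono) auto
      finally show "w \<in> H" by (simp add: H_def)
    qed
    then have "closure (near_norming_values \<Lambda> u z \<delta>) \<subseteq> H"
      by (rule closure_minimal) (simp add: H_def closed_halfspace_le)
    then have "convex hull (closure (near_norming_values \<Lambda> u z \<delta>)) \<subseteq> H"
      by (rule hull_minimal) (simp add: H_def convex_halfspace_le)
    then have "(1 - \<delta>)\<^sup>2 \<le> norm (u + smul c z)"
      using assms[OF \<delta>(1)] by (auto simp: H_def)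
    moreover have "1 - 2 * \<delta> \<le> (1 - \<delta>)\<^sup>2"
      by (simp add: power2_diff)
    ultimately show "1 \<le> norm (u + smul c z) + e"
      using \<delta>(3) by linarith
  qed
  then show ?thesis by (simp add: birkhoff_james_orthogonal_def norm_u)
qed

text \<open>This is the obstruction to strict separation of the limit set from the origin; it also
  shows that the limit set is nonempty.\<close>

lemma exists_limit_value_in_halfspace:
  assumes "one_norming \<Lambda>" and orth: "birkhoff_james_orthogonal smul u z"
  shows "\<exists>l \<in> limit_values \<Lambda> u z. a \<bullet> l \<le> 0"
proof -
  interpret normed_space_over smul by (rule space)
  define t where "t n = inverse (real (Suc n))" for n
  have t: "0 < t n" "t n \<le> 1" for n
    by (auto simp: t_def inverse_le_1_iff)
  have t0: "t \<longlonglongrightarrow> 0"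
    unfolding t_def by (rule LIMSEQ_inverse_real_of_nat)
  \<comment> \<open>The direction \<open>- scalar_cnj a\<close> turns the inner product of
    \<open>c n * \<psi> n z\<close> and \<open>\<psi> n u\<close> into
    \<open>- t n * (a \<bullet> w n)\<close>.\<close>
  define c where "c n = of_real (t n) * (- scalar_cnj a)" for n
  define M where "M = norm a * norm z"
  \<comment> \<open>The norming error is of second order in \<open>t n\<close>, so it still vanishes
    after the later division by \<open>t n\<close>.\<close>
  have "\<exists>\<psi>. \<psi> \<in> \<Lambda> \<and> 1 - (t n)\<^sup>2 < norm (\<psi> (u + smul (c n) z))" for n
  proof -
    have ge: "1 \<le> norm (u + smul (c n) z)"
      using orth by (simp add: birkhoff_james_orthogonal_def norm_u)
    then have "u + smul (c n) z \<noteq> 0" by auto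
    moreover have "1 - (t n)\<^sup>2 < norm (u + smul (c n) z)"
      using ge t(1)[of n] by (smt (verit) zero_less_power)
    ultimately show ?thesis
      using one_norming_approx[OF space ball assms(1)] by metis
  qed
  then obtain \<psi> where \<psi>: "\<And>n. \<psi> n \<in> \<Lambda>"
    and gt: "\<And>n. 1 - (t n)\<^sup>2 < norm (\<psi> n (u + smul (c n) z))"
    by metis
  define w where "w n = \<psi> n z * scalar_cnj (\<psi> n u)" for n
  have cz: "norm (c n * \<psi> n z) \<le> t n * M" for n
    using mult_left_mono[OF norm_value_le[OF \<psi>, of n z], of "t n * norm a"] t(1)[of n]
    by (simp add: c_def norm_mult M_def mult.assoc)
  have low: "1 - (t n)\<^sup>2 - t n * M \<le> norm (\<psi> n u)" for n
    using gt[of n] cz[of n] norm_triangle_ineq[of "\<psi> n u" "c n * \<psi> n z"]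
    by (simp add: value_add_smul[OF \<psi>])
  have lim_u: "(\<lambda>n. norm (\<psi> n u)) \<longlonglongrightarrow> 1"
  proof (rule tendsto_sandwich[of "\<lambda>n. 1 - (t n)\<^sup>2 - t n * M" _ _ "\<lambda>_. 1"])
    have "(\<lambda>n. 1 - (t n)\<^sup>2 - t n * M) \<longlonglongrightarrow> 1 - 0\<^sup>2 - 0 * M"
      by (intro tendsto_intros t0)
    then show "(\<lambda>n. 1 - (t n)\<^sup>2 - t n * M) \<longlonglongrightarrow> 1" by simp
  qed (use low norm_value_le[OF \<psi>, of _ u] norm_u in auto)
  \<comment> \<open>The squared norm of \<open>\<psi> n (u + smul (c n) z)\<close> is at least
    \<open>1 - 2 * (t n)\<^sup>2\<close> and at most
    \<open>1 + (t n * M)\<^sup>2 - 2 * t n * (a \<bullet> w n)\<close>. Comparing the two and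
    dividing by \<open>2 * t n\<close> gives the bound.\<close>
  have upper: "a \<bullet> w n \<le> t n * (1 + M\<^sup>2 / 2)" for n
  proof -
    have inner: "(c n * \<psi> n z) \<bullet> \<psi> n u = - t n * (a \<bullet> w n)"
    proof -
      have "(c n * \<psi> n z) \<bullet> \<psi> n u = t n * ((- scalar_cnj a * \<psi> n z) \<bullet> \<psi> n u)"
        by (simp add: c_def flip: scaleR_conv_of_real)
      also have "(- scalar_cnj a * \<psi> n z) \<bullet> \<psi> n u = - (a \<bullet> w n)"
        using inner_mult_left_scalar_cnj[of "scalar_cnj a" "\<psi> n z" "\<psi> n u"]
        by (simp add: w_def inner_commute)
      finally show ?thesis by simp
    qed
    have "1 - 2 * (t n)\<^sup>2 \<le> (1 - (t n)\<^sup>2)\<^sup>2"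
      by (simp add: power2_diff)
    also have "\<dots> \<le> (norm (\<psi> n u + c n * \<psi> n z))\<^sup>2"
      using gt[of n] t[of n] by (intro power_mono) (auto simp: value_add_smul[OF \<psi>] power_le_one)
    also have "\<dots> = (norm (\<psi> n u))\<^sup>2 + (norm (c n * \<psi> n z))\<^sup>2 - 2 * t n * (a \<bullet> w n)"
      using inner by (simp add: power2_norm_eq_inner inner_add_left inner_add_right inner_commute)
    also have "\<dots> \<le> 1\<^sup>2 + (t n * M)\<^sup>2 - 2 * t n * (a \<bullet> w n)"
      using cz[of n] norm_value_le[OF \<psi>, of n u] norm_u
      by (intro add_mono diff_right_mono power_mono) auto
    finally have "t n * (a \<bullet> w n) \<le> t n * (t n * (1 + M\<^sup>2 / 2))"
      by (simp add: power2_eq_square algebra_simps)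
    then show ?thesis
      using t(1)[of n] by simp
  qed
  have "bounded (range w)"
    using norm_value_product_le[OF \<psi>] by (auto simp: bounded_iff w_def)
  then obtain l r where r: "strict_mono (r :: nat \<Rightarrow> nat)" and l: "(w \<circ> r) \<longlonglongrightarrow> l"
    using bounded_imp_convergent_subsequence by blast
  have "l \<in> limit_values \<Lambda> u z"
    unfolding limit_values_def
    using \<psi> l LIMSEQ_subseq_LIMSEQ[OF lim_u r]
    by (intro CollectI exI[of _ l] exI[of _ "\<lambda>n. \<psi> (r n)"]) (auto simp: o_def w_def)
  moreover have "a \<bullet> l \<le> 0"
  proof (rule LIMSEQ_le)
    show "(\<lambda>n. a \<bullet> (w \<circ> r) n) \<longlonglongrightarrow> a \<bullet> l"
      by (intro tendsto_intros l)
    show "(\<lambda>n. t (r n) * (1 + M\<^sup>2 / 2)) \<longlonglongrightarrow> 0"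
      using tendsto_mult_right[OF LIMSEQ_subseq_LIMSEQ[OF t0 r], of "1 + M\<^sup>2 / 2"]
      by (simp add: o_def)
  qed (use upper in auto)
  ultimately show ?thesis by blast
qed

text \<open>The member for \<open>\<delta> = 1\<close> is already bounded. Compactness passes to the
  convex hull in finite dimension, which makes the hull closed for the separation argument.\<close>

lemma compact_Inter_closure_near_norming_values:
  "compact (\<Inter>\<delta>\<in>{0::real<..}. closure (near_norming_values \<Lambda> u z \<delta>))"
proof -
  have "bounded (near_norming_values \<Lambda> u z 1)"
    using norm_value_product_le by (auto simp: bounded_iff near_norming_values_def)
  then have "bounded (\<Inter>\<delta>\<in>{0::real<..}. closure (near_norming_values \<Lambda> u z \<delta>))"
    by (rule bounded_subset[OF bounded_closure]) auto
  then show ?thesis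
    by (auto simp: compact_eq_bounded_closed)
qed

end

section \<open>Equivalence of the five conditions\<close>

theorem corollary2p6:
  fixes smul :: "'k::real_or_complex \<Rightarrow> 'z::banach \<Rightarrow> 'z"
    and u z :: 'z
    and \<Lambda> :: "('z \<Rightarrow> 'k) set"
  assumes "normed_space_over smul"
    and "u \<in> sphere 0 1"
    and "\<Lambda> \<subseteq> dual_unit_ball smul"
    and "one_norming \<Lambda>"
  shows
    "(birkhoff_james_orthogonal smul u z \<longleftrightarrow>
        0 \<in> convex hull {\<theta>\<^sub>0 * l | \<theta>\<^sub>0 l \<psi>. (\<forall>n::nat. \<psi> n \<in> \<Lambda>) \<and> \<theta>\<^sub>0 \<in> sphere 0 1 \<and>
            (\<lambda>n. \<psi> n u) \<longlonglongrightarrow> scalar_cnj \<theta>\<^sub>0 \<and> (\<lambda>n. \<psi> n z) \<longlonglongrightarrow> l}) \<and>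
     (birkhoff_james_orthogonal smul u z \<longleftrightarrow>
        0 \<in> convex hull {l | l \<psi>. (\<forall>n::nat. \<psi> n \<in> \<Lambda>) \<and>
            (\<lambda>n. norm (\<psi> n u)) \<longlonglongrightarrow> 1 \<and> (\<lambda>n. \<psi> n z * scalar_cnj (\<psi> n u)) \<longlonglongrightarrow> l}) \<and>
     (birkhoff_james_orthogonal smul u z \<longleftrightarrow>
        0 \<in> convex hull (\<Inter>\<delta>\<in>{0::real<..}.
            closure {\<psi> z * scalar_cnj (\<psi> u) | \<psi>. \<psi> \<in> \<Lambda> \<and> norm (\<psi> u) > 1 - \<delta>})) \<and>
     (birkhoff_james_orthogonal smul u z \<longleftrightarrow>
        0 \<in> (\<Inter>\<delta>\<in>{0::real<..}. convex hull
            (closure {\<psi> z * scalar_cnj (\<psi> u) | \<psi>. \<psi> \<in> \<Lambda> \<and> norm (\<psi> u) > 1 - \<delta>})))"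
proof -
  have u: "norm u = 1" using assms(2) by simp
  define K where "K = (\<Inter>\<delta>\<in>{0::real<..}. closure (near_norming_values \<Lambda> u z \<delta>))"
  have le: "norm (\<psi> x) \<le> norm x" if "\<psi> \<in> \<Lambda>" for \<psi> x
    using norm_value_le[OF assms(1) u assms(3) that] .
  \<comment> \<open>This closes the cycle of inclusions, so (ii), (iii) and (iv) concern the same
    set \<open>K\<close>.\<close>
  have "K \<subseteq> rotated_limit_values \<Lambda> u z"
    unfolding K_def
    by (rule Inter_closure_near_norming_values_subset) (use le[of _ u] le[of _ z] u in auto)
  then have eq: "rotated_limit_values \<Lambda> u z = K" "limit_values \<Lambda> u z = K"
    using rotated_limit_values_subset[of \<Lambda> u z] limit_values_subset[of \<Lambda> u z]
    by (auto simp: K_def)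
  have i_iv: "0 \<in> convex hull K" if orth: "birkhoff_james_orthogonal smul u z"
  proof (rule ccontr)
    assume "0 \<notin> convex hull K"
    moreover have "closed (convex hull K)"
      using compact_Inter_closure_near_norming_values[OF assms(1) u assms(3), of z]
      by (simp add: K_def compact_convex_hull compact_imp_closed)
    \<comment> \<open>Separation in the scalar field, viewed as a real Euclidean space, keeps
      \<open>a \<bullet> x\<close> above a positive constant on the hull, whereas orthogonality
      yields a point of \<open>K\<close> with \<open>a \<bullet> l \<le> 0\<close>.\<close>
    ultimately obtain a b where "0 < b" "\<forall>x\<in>convex hull K. a \<bullet> x > b"
      using separating_hyperplane_closed_0[of "convex hull K"] by auto
    moreover obtain l where "l \<in> K" "a \<bullet> l \<le> 0"
      using exists_limit_value_in_halfspace[OF assms(1) u assms(3,4) orth, of a] eq by auto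
    ultimately show False
      using hull_inc[of l K convex] by force
  qed
  \<comment> \<open>\<open>K\<close> lies in each closure, and taking hulls is monotone.\<close>
  have iv_v: "convex hull K \<subseteq>
      (\<Inter>\<delta>\<in>{0::real<..}. convex hull (closure (near_norming_values \<Lambda> u z \<delta>)))"
    unfolding K_def by (intro INF_greatest hull_mono INF_lower)
  have v_i: "birkhoff_james_orthogonal smul u z"
    if "0 \<in> (\<Inter>\<delta>\<in>{0::real<..}. convex hull (closure (near_norming_values \<Lambda> u z \<delta>)))"
    using birkhoff_james_orthogonal_if_hull[OF assms(1) u assms(3), of z] that by auto
  have iv: "birkhoff_james_orthogonal smul u z \<longleftrightarrow> 0 \<in> convex hull K"
    and v: "birkhoff_james_orthogonal smul u z \<longleftrightarrow>
      0 \<in> (\<Inter>\<delta>\<in>{0::real<..}. convex hull (closure (near_norming_values \<Lambda> u z \<delta>)))"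
    using i_iv iv_v v_i by blast+
  show ?thesis
    by (intro conjI iv[folded eq(1), unfolded rotated_limit_values_def]
        iv[folded eq(2), unfolded limit_values_def]
        iv[unfolded K_def near_norming_values_def] v[unfolded near_norming_values_def])
qed

end
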